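(* Let $0<s_1<s_2<1$, $1\le r\le p<\infty$, let $\Omega\subseteq\mathbb{R}^N$ be open and $H\subseteq\Omega\times\Omega$ measurable, and let $A$ be a bounded (measurable) vector field, with values in $\mathbb{R}^N$, on the convex hull of $\Omega$. Then, if $r<p$, for any $f\in L^p(\Omega,\mathbb{C})$ $$\iint_H\frac{\left|f(x)-e^{i(x-y)\cdot A\left(\frac{x+y}{2}\right)}f(y)\right|^r}{|x-y|^{N+s_1r}}\,dx\,dy\le\left(\iint_H\frac{\left|f(x)-e^{i(x-y)\cdot A\left(\frac{x+y}{2}\right)}f(y)\right|^p}{|x-y|^{N+s_2p}}\,dx\,dy\right)^{\frac rp}\left(\iint_H|x-y|^{\frac{Nr+s_2rp-Np-s_1rp}{p-r}}\,dx\,dy\right)^{\frac{p-r}{p}}.$$ Moreover (for $1\le r\le p<\infty$), if $\Omega$ is bounded, then for some constant $C=C(\Omega,N,p,r)>0$ and every $f\in L^p(\Omega,\mathbb{C})$ $$[f]_{W^{s_1,r}_A(\Omega,\mathbb{C})}^r\le\frac{C(\Omega,N,p,r)}{(s_2-s_1)^{\frac{p-r}{r}}}\,[f]_{W^{s_2,p}_A(\Omega,\mathbb{C})}^r.$$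
   Context: For $s\in(0,1)$, $p\in[1,\infty)$, an open set $\Omega\subseteq\mathbb{R}^N$ and a vector field $A$ on the convex hull of $\Omega$, $$[f]_{W^{s,p}_A(\Omega,\mathbb{C})}:=\left(\iint_{\Omega\times\Omega}\frac{\left|f(x)-e^{i(x-y)\cdot A\left(\frac{x+y}{2}\right)}f(y)\right|^p}{|x-y|^{N+sp}}\,dx\,dy\right)^{1/p}.$$ Integrals and seminorms may take the value $+\infty$, with the convention $0\cdot\infty=0$. *)

theory Defs
  imports "HOL-Analysis.Analysis"
begin

text \<open>
  Functions on a subset of \<open>\<real>\<^sup>N\<close> are total functions, only constrained and only used on that subset.
  \<open>N\<close> is \<open>CARD('n)\<close>, and double integrals are taken with respect to the Lebesgue measure
  of \<open>\<real>\<^sup>N \<times> \<real>\<^sup>N\<close>, with values in \<open>ennreal\<close> (where \<open>0 * \<infinity> = 0\<close>).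
\<close>

text \<open>Real powers of extended non-negative numbers; meant for positive exponents only.\<close>

definition enn_powr :: "ennreal \<Rightarrow> real \<Rightarrow> ennreal" where
  "enn_powr t a = (if t = \<infinity> then \<infinity> else ennreal (enn2real t powr a))"

definition in_Lp :: "(real ^ 'n) set \<Rightarrow> real \<Rightarrow> (real ^ 'n \<Rightarrow> complex) \<Rightarrow> bool" where
  "in_Lp \<Omega> p f \<longleftrightarrow> f \<in> borel_measurable (lebesgue_on \<Omega>) \<and>
     integrable (lebesgue_on \<Omega>) (\<lambda>x. norm (f x) powr p)"

definition magnetic_diff ::
  "(real ^ 'n \<Rightarrow> real ^ 'n) \<Rightarrow> (real ^ 'n \<Rightarrow> complex) \<Rightarrow> real ^ 'n \<Rightarrow> real ^ 'n \<Rightarrow> complex" where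
  "magnetic_diff A f x y =
     f x - exp (\<i> * complex_of_real ((x - y) \<bullet> A ((1 / 2) *\<^sub>R (x + y)))) * f y"

text \<open>On the diagonal, a null set, the quotient below is \<open>0 / 0 = 0\<close>.\<close>

definition magnetic_energy ::
  "((real ^ 'n) \<times> (real ^ 'n)) set \<Rightarrow> (real ^ 'n \<Rightarrow> real ^ 'n) \<Rightarrow> real \<Rightarrow> real
    \<Rightarrow> (real ^ 'n \<Rightarrow> complex) \<Rightarrow> ennreal" where
  "magnetic_energy H A s p f =
     (\<integral>\<^sup>+(x, y)\<in>H. ennreal (norm (magnetic_diff A f x y) powr p
                        / norm (x - y) powr (real CARD('n) + s * p)) \<partial>lebesgue)"

definition magnetic_seminorm ::
  "(real ^ 'n) set \<Rightarrow> (real ^ 'n \<Rightarrow> real ^ 'n) \<Rightarrow> real \<Rightarrow> real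
    \<Rightarrow> (real ^ 'n \<Rightarrow> complex) \<Rightarrow> ennreal" where
  "magnetic_seminorm \<Omega> A s p f = enn_powr (magnetic_energy (\<Omega> \<times> \<Omega>) A s p f) (1 / p)"

definition bounded_field :: "(real ^ 'n) set \<Rightarrow> (real ^ 'n \<Rightarrow> real ^ 'n) \<Rightarrow> bool" where
  "bounded_field \<Omega> A \<longleftrightarrow> A \<in> borel_measurable (lebesgue_on (convex hull \<Omega>)) \<and>
     bounded (A ` (convex hull \<Omega>))"

end

theory Submission
  imports Defs
begin

text \<open>
  Write the integrand of the \<open>(s1, r)\<close> energy as \<open>u powr (r / p) * v powr (1 - r / p)\<close> with \<open>u\<close> the
  integrand of the \<open>(s2, p)\<close> energy and \<open>v\<close> a power of \<open>|x - y|\<close>, and apply Hoelder's inequality.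
  On a bounded \<open>\<Omega>\<close> with \<open>\<delta> = s2 - s1\<close> the exponent of \<open>v\<close> is \<open>\<delta> * r * p / (p - r) - N\<close>, so the integral
  of \<open>v\<close> is \<open>O(1 / \<delta>)\<close>. This even gives the factor \<open>\<delta> powr (- (p - r) / p)\<close>, which is at most
  \<open>\<delta> powr (- (p - r) / r)\<close> as \<open>\<delta> < 1\<close> and \<open>r \<le> p\<close>.
\<close>

section \<open>Powers of extended non-negative reals and Hoelder's inequality\<close>

lemma enn_powr_mono:
  assumes "x \<le> y" "0 \<le> a"
  shows "enn_powr x a \<le> enn_powr y a"
  using assms by (cases x; cases y) (auto simp: enn_powr_def top_unique intro!: ennreal_leI powr_mono2)

lemma enn_powr_enn_powr: "enn_powr (enn_powr x a) b = enn_powr x (a * b)"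
  by (auto simp: enn_powr_def powr_powr)

lemma enn_powr_one: "enn_powr x 1 = x"
  by (cases x) (auto simp: enn_powr_def)

lemma enn_powr_ennreal: "0 \<le> x \<Longrightarrow> enn_powr (ennreal x) a = ennreal (x powr a)"
  by (simp add: enn_powr_def)

text \<open>A zero factor makes the left side 0, so only positive \<open>a\<close> and
  \<open>b\<close> need Young's inequality. Zeros do occur in the application, where the functions
  vanish off \<open>H\<close>.\<close>

lemma Youngs_inequality_nonneg:
  fixes a b t :: real
  assumes "0 < t" "t < 1" "0 \<le> a" "0 \<le> b"
  shows "a powr t * b powr (1 - t) \<le> t * a + (1 - t) * b"
proof (cases "a = 0 \<or> b = 0")
  case False
  then show ?thesis using Youngs_inequality_0[of t "1 - t" a b] assms by auto
qed (use assms in auto)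

text \<open>Dividing \<open>u\<close> and \<open>v\<close> by their integrals reduces the claim to
  Young's inequality at each point. This needs both integrals to be positive and finite; the
  remaining cases are settled by the conventions for 0 and infinity.\<close>

lemma nn_integral_Holder:
  fixes u v :: "'a \<Rightarrow> real"
  assumes t: "0 < t" "t < 1"
    and u: "u \<in> borel_measurable M" "\<And>x. 0 \<le> u x"
    and v: "v \<in> borel_measurable M" "\<And>x. 0 \<le> v x"
  shows "(\<integral>\<^sup>+x. ennreal (u x powr t * v x powr (1 - t)) \<partial>M)
    \<le> enn_powr (\<integral>\<^sup>+x. ennreal (u x) \<partial>M) t * enn_powr (\<integral>\<^sup>+x. ennreal (v x) \<partial>M) (1 - t)"
    (is "?L \<le> enn_powr ?U t * enn_powr ?V (1 - t)")
proof -
  note [measurable] = u(1) v(1)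
  \<comment> \<open>Since \<open>0 * \<infinity> = 0\<close>, the right side vanishes as soon as one
    integral does, even if the other is infinite. So the left side has to be 0 as well.\<close>
  have zero: "?L = 0" if "?U = 0 \<or> ?V = 0"
  proof -
    have "(AE x in M. u x = 0) \<or> (AE x in M. v x = 0)"
      using that u(2) v(2) by (simp add: nn_integral_0_iff_AE ennreal_eq_0_iff antisym_conv)
    then have "AE x in M. ennreal (u x powr t * v x powr (1 - t)) = 0"
      by (elim disjE) (erule eventually_mono; simp)+
    then have "?L = (\<integral>\<^sup>+x. 0 \<partial>M)" by (rule nn_integral_cong_AE)
    then show ?thesis by simp
  qed
  have pos: "enn_powr z a \<noteq> 0" if "z \<noteq> 0" for z :: ennreal and a
    using that by (cases z) (auto simp: enn_powr_def)
  consider "?U = 0 \<or> ?V = 0" | "?U \<noteq> 0" "?V \<noteq> 0" "?U = \<infinity> \<or> ?V = \<infinity>"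
    | "?U \<noteq> 0" "?V \<noteq> 0" "?U \<noteq> \<infinity>" "?V \<noteq> \<infinity>" by blast
  then show ?thesis
  proof cases
    case 1
    then show ?thesis using zero by simp
  next
    case 2
    have "enn_powr \<infinity> b = \<infinity>" for b by (simp add: enn_powr_def)
    then have "enn_powr ?U t * enn_powr ?V (1 - t) = \<infinity>"
      using 2(3) pos[OF 2(1), of t] pos[OF 2(2), of "1 - t"]
      by (elim disjE) (simp_all add: ennreal_mult_eq_top_iff)
    then show ?thesis by simp
  next
    case 3
    then obtain a b where a: "?U = ennreal a" "0 < a" and b: "?V = ennreal b" "0 < b"
      by (cases ?U; cases ?V) (auto simp: less_le)
    \<comment> \<open>\<open>c\<close> is the right side of the claim. Young's inequality for
      \<open>u x / a\<close> and \<open>v x / b\<close> has the upper bound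
      \<open>\<alpha> * u x + \<beta> * v x\<close>, whose integral is 1.\<close>
    define c \<alpha> \<beta> where "c = a powr t * b powr (1 - t)" and "\<alpha> = t / a" and "\<beta> = (1 - t) / b"
    have nonneg: "0 \<le> c" "0 \<le> \<alpha>" "0 \<le> \<beta>"
      using a b t by (auto simp: c_def \<alpha>_def \<beta>_def)
    have sum: "\<alpha> * a + \<beta> * b = 1"
      using a b by (simp add: \<alpha>_def \<beta>_def)
    have "u x powr t * v x powr (1 - t) \<le> c * (\<alpha> * u x + \<beta> * v x)" for x
    proof -
      have "u x powr t * v x powr (1 - t) = c * ((u x / a) powr t * (v x / b) powr (1 - t))"
        using a b u(2)[of x] v(2)[of x] by (simp add: c_def powr_divide)
      also have "\<dots> \<le> c * (t * (u x / a) + (1 - t) * (v x / b))"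
        using a b u(2)[of x] v(2)[of x] t nonneg
        by (intro mult_left_mono Youngs_inequality_nonneg) auto
      finally show ?thesis by (simp add: \<alpha>_def \<beta>_def)
    qed
    then have "?L \<le> (\<integral>\<^sup>+x. ennreal (c * (\<alpha> * u x + \<beta> * v x)) \<partial>M)"
      by (intro nn_integral_mono ennreal_leI)
    also have "\<dots> = (\<integral>\<^sup>+x. ennreal c * (ennreal \<alpha> * ennreal (u x) + ennreal \<beta> * ennreal (v x)) \<partial>M)"
      using nonneg u(2) v(2) by (intro nn_integral_cong) (simp add: ennreal_mult)
    also have "\<dots> = ennreal c * (ennreal \<alpha> * ?U + ennreal \<beta> * ?V)"
      by (simp add: nn_integral_cmult nn_integral_add)
    also have "\<dots> = ennreal (c * (\<alpha> * a + \<beta> * b))"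
      using nonneg a b by (simp only: ennreal_mult ennreal_plus mult_nonneg_nonneg add_nonneg_nonneg less_imp_le)
    also have "\<dots> = ennreal c" by (simp add: sum)
    finally show ?thesis
      using a b by (simp add: c_def enn_powr_ennreal ennreal_mult)
  qed
qed

section \<open>Lebesgue measurability of the integrands\<close>

text \<open>A Lebesgue set is a Borel set up to a subset of a Borel null set, so its preimage is
  again Lebesgue once preimages of null sets are null. This allows composing a merely Lebesgue
  measurable function with \<open>g\<close>.\<close>

lemma measurable_lebesgue_lebesgue:
  fixes g :: "'a::euclidean_space \<Rightarrow> 'b::euclidean_space"
  assumes g: "g \<in> borel_measurable borel"
    and null: "\<And>N. N \<in> null_sets lborel \<Longrightarrow> emeasure lborel (g -` N) = 0"
  shows "g \<in> lebesgue \<rightarrow>\<^sub>M lebesgue"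
proof (rule completion.measurable_completion2)
  have g': "g \<in> lborel \<rightarrow>\<^sub>M lborel" using g by simp
  then show gl: "g \<in> lebesgue \<rightarrow>\<^sub>M lborel" by (rule measurable_completion)
  show "null_sets lborel \<subseteq> null_sets (distr lebesgue lborel g)"
  proof
    fix N :: "'b set" assume N: "N \<in> null_sets lborel"
    then have N_sets: "N \<in> sets lborel" by auto
    then have "g -` N \<in> sets lborel"
      using measurable_sets[OF g', of N] by simp
    then show "N \<in> null_sets (distr lebesgue lborel g)"
      using null[OF N] gl N_sets by (auto simp: null_sets_def emeasure_distr)
  qed
qed

text \<open>By the change of variables \<open>lborel_affine\<close>, the measure of \<open>N\<close>
  is \<open>\<bar>c\<bar>^DIM('a)\<close> times that of its preimage, and this factor is
  nonzero.\<close>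

lemma null_sets_vimage_affine:
  fixes c :: real and t :: "'a::euclidean_space"
  assumes "c \<noteq> 0" "N \<in> null_sets lborel"
  shows "emeasure lborel ((\<lambda>x. t + c *\<^sub>R x) -` N) = 0"
proof -
  have [measurable]: "N \<in> sets borel" using assms by auto
  have [measurable]: "(\<lambda>x. t + c *\<^sub>R x) \<in> borel_measurable borel" by simp
  have "0 = emeasure (density (distr lborel borel (\<lambda>x. t + c *\<^sub>R x)) (\<lambda>_. \<bar>c\<bar>^DIM('a))) N"
    using assms lborel_affine[of c t] by auto
  also have "\<dots> = ennreal (\<bar>c\<bar>^DIM('a)) * emeasure lborel ((\<lambda>x. t + c *\<^sub>R x) -` N)"
    by (subst emeasure_density) (simp_all add: nn_integral_cmult emeasure_distr)
  finally show ?thesis using assms(1) by auto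
qed

text \<open>Fix the variable other than one with a nonzero coefficient: each slice of the preimage
  of a null set is then an affine preimage, hence null, and Tonelli applies. The instances of
  interest are the two projections and the midpoint map.\<close>

lemma measurable_linear_combination_lebesgue:
  fixes a b :: real
  assumes "a \<noteq> 0 \<or> b \<noteq> 0"
  shows "(\<lambda>z. a *\<^sub>R fst z + b *\<^sub>R snd z :: 'a::euclidean_space) \<in> lebesgue \<rightarrow>\<^sub>M lebesgue"
    (is "?g \<in> _")
proof (rule measurable_lebesgue_lebesgue)
  show g: "?g \<in> borel_measurable borel"
    by (intro borel_measurable_continuous_onI continuous_intros)
  fix N :: "'a set" assume N: "N \<in> null_sets lborel"
  then have "N \<in> sets borel" by auto
  then have V: "?g -` N \<in> sets (lborel \<Otimes>\<^sub>M lborel)"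
    unfolding lborel_prod using measurable_sets[OF g, of N] by simp
  show "emeasure lborel (?g -` N) = 0"
  proof (cases "b = 0")
    case False
    have "emeasure lborel (?g -` N) = (\<integral>\<^sup>+x. emeasure lborel (Pair x -` (?g -` N)) \<partial>lborel)"
      using lborel.emeasure_pair_measure_alt[OF V] by (simp add: lborel_prod)
    also have "\<dots> = (\<integral>\<^sup>+x. emeasure lborel ((\<lambda>y. a *\<^sub>R x + b *\<^sub>R y) -` N) \<partial>lborel)"
      by (simp add: vimage_def)
    finally show ?thesis using null_sets_vimage_affine[OF False N] by simp
  next
    case True
    have "emeasure lborel (?g -` N) = (\<integral>\<^sup>+y. emeasure lborel ((\<lambda>x. (x, y)) -` (?g -` N)) \<partial>lborel)"
      using lborel_pair.emeasure_pair_measure_alt2[OF V] by (simp add: lborel_prod)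
    also have "\<dots> = (\<integral>\<^sup>+y. emeasure lborel ((\<lambda>x. b *\<^sub>R y + a *\<^sub>R x) -` N) \<partial>lborel)"
      by (simp add: vimage_def add.commute)
    also have "\<dots> = 0"
      using null_sets_vimage_affine[of a N 0] assms True N by simp
    finally show ?thesis .
  qed
qed

lemma borel_measurable_magnetic_diff:
  fixes f :: "real ^ 'n \<Rightarrow> complex" and A :: "real ^ 'n \<Rightarrow> real ^ 'n"
  assumes f: "f \<in> borel_measurable lebesgue" and A: "A \<in> borel_measurable lebesgue"
  shows "(\<lambda>z. magnetic_diff A f (fst z) (snd z)) \<in> borel_measurable lebesgue"
proof -
  have [measurable]: "(\<lambda>z::(real^'n) \<times> (real^'n). f (fst z)) \<in> borel_measurable lebesgue"
    using measurable_compose[OF measurable_linear_combination_lebesgue[of 1 0] f] by simp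
  have [measurable]: "(\<lambda>z::(real^'n) \<times> (real^'n). f (snd z)) \<in> borel_measurable lebesgue"
    using measurable_compose[OF measurable_linear_combination_lebesgue[of 0 1] f] by simp
  have [measurable]: "(\<lambda>z. A ((1 / 2) *\<^sub>R (fst z + snd z))) \<in> borel_measurable lebesgue"
    using measurable_compose[OF measurable_linear_combination_lebesgue[of "1/2" "1/2"] A]
    by (simp add: scaleR_add_right)
  have "(\<lambda>z::(real^'n) \<times> (real^'n). fst z - snd z) \<in> borel_measurable borel"
    by (intro borel_measurable_continuous_onI continuous_intros)
  then have [measurable]: "(\<lambda>z::(real^'n) \<times> (real^'n). fst z - snd z) \<in> borel_measurable lebesgue"
    by (simp add: measurable_completion)
  show ?thesis unfolding magnetic_diff_def by measurable
qed

lemma borel_measurable_norm_diff_lebesgue: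
  "(\<lambda>z::'a::euclidean_space \<times> 'a. norm (fst z - snd z)) \<in> borel_measurable lebesgue"
proof -
  have "(\<lambda>z::'a \<times> 'a. norm (fst z - snd z)) \<in> borel_measurable borel"
    by (intro borel_measurable_continuous_onI continuous_intros)
  then show ?thesis by (simp add: measurable_completion)
qed

text \<open>\<open>f\<close> and \<open>A\<close> are only controlled on \<open>\<Omega>\<close> and
  on its convex hull, so both are extended by 0. On \<open>H\<close> this changes nothing, as the
  midpoint of two points of \<open>\<Omega>\<close> lies in the hull.\<close>

lemma borel_measurable_magnetic_energy:
  fixes \<Omega> :: "(real ^ 'n) set"
  assumes "open \<Omega>" and H: "H \<in> sets lebesgue" "H \<subseteq> \<Omega> \<times> \<Omega>"
    and A: "bounded_field \<Omega> A" and f: "in_Lp \<Omega> q f"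
  shows "(\<lambda>(x, y). norm (magnetic_diff A f x y) powr p
            / norm (x - y) powr (real CARD('n) + s * p) * indicator H (x, y))
    \<in> borel_measurable lebesgue"
proof -
  define f' where "f' x = (if x \<in> \<Omega> then f x else 0)" for x
  define A' where "A' x = (if x \<in> convex hull \<Omega> then A x else 0)" for x
  define F where "F z = magnetic_diff A' f' (fst z) (snd z)" for z
  have F_eq: "magnetic_diff A f x y = F (x, y)" if "(x, y) \<in> H" for x y
  proof -
    have xy: "x \<in> \<Omega>" "y \<in> \<Omega>" using that H by auto
    then have "(1/2) *\<^sub>R x + (1/2) *\<^sub>R y \<in> convex hull \<Omega>"
      by (intro convexD[OF convex_convex_hull]) (auto intro: hull_inc)
    with xy show ?thesis
      by (simp add: F_def magnetic_diff_def f'_def A'_def scaleR_add_right)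
  qed
  have "f' \<in> borel_measurable lebesgue"
    using f \<open>open \<Omega>\<close> unfolding f'_def in_Lp_def by (subst borel_measurable_if) auto
  moreover have "A' \<in> borel_measurable lebesgue"
    using A open_convex_hull[OF \<open>open \<Omega>\<close>] unfolding A'_def bounded_field_def
    by (subst borel_measurable_if) auto
  ultimately have [measurable]: "F \<in> borel_measurable lebesgue"
    unfolding F_def by (rule borel_measurable_magnetic_diff)
  note [measurable] = H(1) borel_measurable_norm_diff_lebesgue
  have "(\<lambda>z. norm (F z) powr p / norm (fst z - snd z) powr (real CARD('n) + s * p) * indicator H z)
      \<in> borel_measurable lebesgue" by measurable
  also have "(\<lambda>z. norm (F z) powr p / norm (fst z - snd z) powr (real CARD('n) + s * p) * indicator H z)
      = (\<lambda>(x, y). norm (magnetic_diff A f x y) powr p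
          / norm (x - y) powr (real CARD('n) + s * p) * indicator H (x, y))"
    by (auto simp: F_eq split: split_indicator)
  finally show ?thesis .
qed

section \<open>Hoelder's inequality for magnetic energies\<close>

lemma magnetic_energy_Holder:
  fixes \<Omega> :: "(real ^ 'n) set"
  assumes pr: "1 \<le> r" "r < p" and "open \<Omega>"
    and H: "H \<in> sets lebesgue" "H \<subseteq> \<Omega> \<times> \<Omega>"
    and A: "bounded_field \<Omega> A" and f: "in_Lp \<Omega> p f"
  shows "magnetic_energy H A s1 r f
    \<le> enn_powr (magnetic_energy H A s2 p f) (r / p)
       * enn_powr
           (\<integral>\<^sup>+(x, y)\<in>H. ennreal (norm (x - y) powr
               ((real CARD('n) * r + s2 * r * p - real CARD('n) * p - s1 * r * p) / (p - r)))
             \<partial>lebesgue)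
           ((p - r) / p)"
proof -
  let ?N = "real CARD('n)"
  let ?e = "(?N * r + s2 * r * p - ?N * p - s1 * r * p) / (p - r)"
  \<comment> \<open>Both functions carry the indicator of \<open>H\<close>, so Hoelder's inequality
    can be applied on the whole space.\<close>
  define u where "u = (\<lambda>(x, y). norm (magnetic_diff A f x y) powr p
      / norm (x - y) powr (?N + s2 * p) * indicator H (x, y))"
  define v where "v z = norm (fst z - snd z) powr ?e * indicator H z" for z :: "(real^'n) \<times> (real^'n)"
  note [measurable] = H(1) borel_measurable_norm_diff_lebesgue
  have "u \<in> borel_measurable lebesgue"
    unfolding u_def by (rule borel_measurable_magnetic_energy) fact+
  moreover have "v \<in> borel_measurable lebesgue"
    unfolding v_def by measurable
  ultimately have Holder: "(\<integral>\<^sup>+z. ennreal (u z powr (r / p) * v z powr (1 - r / p)) \<partial>lebesgue)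
      \<le> enn_powr (\<integral>\<^sup>+z. ennreal (u z) \<partial>lebesgue) (r / p)
        * enn_powr (\<integral>\<^sup>+z. ennreal (v z) \<partial>lebesgue) (1 - r / p)"
    using pr by (intro nn_integral_Holder) (auto simp: u_def v_def)
  \<comment> \<open>\<open>?e\<close> is the exponent that balances the powers of
    \<open>norm (x - y)\<close> in the product of \<open>u powr (r / p)\<close> and
    \<open>v powr (1 - r / p)\<close>.\<close>
  have exps: "?e * (1 - r / p) = (?N + s2 * p) * (r / p) - (?N + s1 * r)"
  proof -
    have "1 - r / p = (p - r) / p" using pr by (simp add: field_simps)
    then have "?e * (1 - r / p) = (?N * r + s2 * r * p - ?N * p - s1 * r * p) / p"
      using pr by simp
    then show ?thesis using pr by (simp add: field_simps)
  qed
  have *: "ennreal (norm (magnetic_diff A f x y) powr r / norm (x - y) powr (?N + s1 * r)) * indicator H (x, y)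
      = ennreal (u (x, y) powr (r / p) * v (x, y) powr (1 - r / p))" for x y
  proof (cases "(x, y) \<in> H \<and> x \<noteq> y")
    case True
    let ?d = "norm (x - y)"
    have d: "0 < ?d" using True by simp
    have "u (x, y) powr (r / p)
        = norm (magnetic_diff A f x y) powr r / ?d powr ((?N + s2 * p) * (r / p))"
      using True pr by (simp add: u_def powr_divide powr_powr)
    moreover have "v (x, y) powr (1 - r / p) = ?d powr (?e * (1 - r / p))"
      using True by (simp add: v_def powr_powr)
    then have "v (x, y) powr (1 - r / p) = ?d powr ((?N + s2 * p) * (r / p)) / ?d powr (?N + s1 * r)"
      unfolding exps by (simp only: powr_diff)
    ultimately show ?thesis using True d by simp
  next
    \<comment> \<open>Off \<open>H\<close> the indicators vanish. On the diagonal both sides are 0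
      because \<open>0 powr a = 0\<close> and division by 0 gives 0.\<close>
    case False
    then show ?thesis by (auto simp: u_def v_def)
  qed
  have "magnetic_energy H A s1 r f = (\<integral>\<^sup>+z. ennreal (u z powr (r / p) * v z powr (1 - r / p)) \<partial>lebesgue)"
    unfolding magnetic_energy_def using *[of "fst z" "snd z" for z]
    by (intro nn_integral_cong) (simp add: split_beta)
  also note Holder
  also have "(\<integral>\<^sup>+z. ennreal (u z) \<partial>lebesgue) = magnetic_energy H A s2 p f"
    unfolding magnetic_energy_def
    by (rule nn_integral_cong) (auto simp: u_def split: split_indicator)
  also have "(\<integral>\<^sup>+z. ennreal (v z) \<partial>lebesgue)
      = (\<integral>\<^sup>+(x, y)\<in>H. ennreal (norm (x - y) powr ?e) \<partial>lebesgue)"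
    by (rule nn_integral_cong) (auto simp: v_def split: split_indicator)
  also have "1 - r / p = (p - r) / p" using pr by (simp add: field_simps)
  finally show ?thesis .
qed

section \<open>Integrals of powers of the distance\<close>

text \<open>
  Instead of using polar coordinates, \<open>norm z powr (\<alpha> - n)\<close> is bounded by \<open>2 ^ (n + 1)\<close> times the
  integral of \<open>t powr (\<alpha> - n - 1)\<close> over \<open>norm z \<le> t \<le> 2 * norm z\<close>; Tonelli then leaves
  the volume of a ball of radius \<open>t\<close> inside.
\<close>

lemma nn_integral_norm_powr_cball_le:
  fixes \<alpha> d :: real
  defines "n \<equiv> DIM('a::euclidean_space)"
  assumes \<alpha>: "0 < \<alpha>" and d: "0 \<le> d"
  shows "(\<integral>\<^sup>+z\<in>cball (0::'a) d. ennreal (norm z powr (\<alpha> - n)) \<partial>lborel)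
    \<le> ennreal (2 ^ (n + 1) * unit_ball_vol n * ((2 * d) powr \<alpha> / \<alpha>))"
proof -
  \<comment> \<open>The bound \<open>t \<le> 2 * d\<close> holds for all relevant \<open>t\<close>
    when \<open>z\<close> is in the ball; it keeps the outer integral over \<open>t\<close>
    finite.\<close>
  define k where "k z t = ennreal (t powr (\<alpha> - n - 1)) *
      (if norm z \<le> t \<and> t \<le> 2 * norm z \<and> 0 \<le> t \<and> t \<le> 2 * d then 1 else 0)" for z :: 'a and t
  have [measurable]: "(\<lambda>(z, t). k z t) \<in> borel_measurable (lborel \<Otimes>\<^sub>M lborel)"
    unfolding k_def by measurable
  \<comment> \<open>The exponent \<open>\<alpha> - n - 1\<close> may have either sign, so
    \<open>powr\<close> need not be monotone in its base here. Numerator and denominator of the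
    quotient are both increasing and can be compared separately.\<close>
  have split: "s powr (\<alpha> - n - 1) = s powr \<alpha> / s ^ (n + 1)" if "0 < s" for s
    using that powr_diff[of s \<alpha> "real (n + 1)"] powr_realpow[of s "n + 1"]
    by (simp add: algebra_simps)
  have pointwise: "ennreal (norm z powr (\<alpha> - n)) * indicator (cball 0 d) z
      \<le> ennreal (2 ^ (n + 1)) * (\<integral>\<^sup>+t. k z t \<partial>lborel)" for z
  proof (cases "z \<noteq> 0 \<and> norm z \<le> d")
    case True
    let ?z = "norm z"
    have z: "0 < ?z" using True by simp
    have "ennreal (?z powr (\<alpha> - n)) = ennreal (2 ^ (n + 1)) * ennreal (?z powr (\<alpha> - n) / 2 ^ (n + 1))"
      by (simp flip: ennreal_mult')
    \<comment> \<open>The interval from \<open>?z\<close> to \<open>2 * ?z\<close> has length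
      \<open>?z\<close>, which supplies the missing power.\<close>
    also have "ennreal (?z powr (\<alpha> - n) / 2 ^ (n + 1))
        = (\<integral>\<^sup>+t. ennreal (?z powr (\<alpha> - n - 1) / 2 ^ (n + 1)) * indicator {?z..2 * ?z} t \<partial>lborel)"
      using z by (simp add: nn_integral_cmult_indicator powr_diff flip: ennreal_mult')
    also have "\<dots> \<le> (\<integral>\<^sup>+t. k z t \<partial>lborel)"
    proof (rule nn_integral_mono)
      fix t
      have "?z powr (\<alpha> - n - 1) / 2 ^ (n + 1) \<le> t powr (\<alpha> - n - 1)" if "?z \<le> t" "t \<le> 2 * ?z"
      proof -
        have t: "0 < t" using that(1) z by linarith
        have "?z powr (\<alpha> - n - 1) / 2 ^ (n + 1) = ?z powr \<alpha> / (2 * ?z) ^ (n + 1)"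
          unfolding split[OF z] by (simp add: power_mult_distrib field_simps)
        also have "\<dots> \<le> t powr \<alpha> / t ^ (n + 1)"
          using that z t \<alpha> by (intro frac_le powr_mono2 power_mono) auto
        also have "\<dots> = t powr (\<alpha> - n - 1)"
          using split[OF t] by simp
        finally show ?thesis .
      qed
      then show "ennreal (?z powr (\<alpha> - n - 1) / 2 ^ (n + 1)) * indicator {?z..2 * ?z} t \<le> k z t"
        using True z unfolding k_def by (auto split: split_indicator intro!: ennreal_leI)
    qed
    finally show ?thesis using True by (simp add: mult_left_mono)
  \<comment> \<open>At \<open>z = 0\<close> the left side is 0, since \<open>0 powr a = 0\<close>
    for every \<open>a\<close>.\<close>
  qed auto
  have "(\<integral>\<^sup>+t. (\<integral>\<^sup>+z. k z t \<partial>lborel) \<partial>lborel)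
      \<le> (\<integral>\<^sup>+t. ennreal (unit_ball_vol n) * (ennreal (t powr (\<alpha> - 1)) * indicator {0..2 * d} t) \<partial>lborel)"
  proof (rule nn_integral_mono)
    fix t
    show "(\<integral>\<^sup>+z. k z t \<partial>lborel)
        \<le> ennreal (unit_ball_vol n) * (ennreal (t powr (\<alpha> - 1)) * indicator {0..2 * d} t)"
    proof (cases "0 < t \<and> t \<le> 2 * d")
      case True
      have "(\<integral>\<^sup>+z. k z t \<partial>lborel)
          \<le> (\<integral>\<^sup>+z. ennreal (t powr (\<alpha> - n - 1)) * indicator (cball (0::'a) t) z \<partial>lborel)"
        by (rule nn_integral_mono) (auto simp: k_def)
      also have "\<dots> = ennreal (t powr (\<alpha> - n - 1)) * ennreal (unit_ball_vol n * t ^ n)"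
        using True by (simp add: nn_integral_cmult_indicator emeasure_cball n_def)
      also have "\<dots> = ennreal (unit_ball_vol n) * ennreal (t powr (\<alpha> - 1))"
      proof -
        have "t powr (\<alpha> - n - 1) * (unit_ball_vol n * t ^ n) = unit_ball_vol n * t powr (\<alpha> - 1)"
          using True split[of t] powr_diff[of t \<alpha> 1] by simp
        then show ?thesis using True by (simp flip: ennreal_mult')
      qed
      finally show ?thesis using True by simp
    next
      case False
      then have "k z t = 0" for z by (auto simp: k_def)
      then show ?thesis by simp
    qed
  qed
  \<comment> \<open>Integrating \<open>t powr (\<alpha> - 1)\<close> from 0 produces the factor
    \<open>1 / \<alpha>\<close>, the source of the blow-up as \<open>s2 - s1\<close> tends to
    0.\<close>
  also have "\<dots> = ennreal (unit_ball_vol n) * ennreal ((2 * d) powr \<alpha> / \<alpha>)"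
    using nn_integral_has_integral_lebesgue'[OF _ has_integral_powr_from_0[of "\<alpha> - 1" "2 * d"]] \<alpha> d
    by (simp add: nn_integral_cmult)
  finally have inner: "(\<integral>\<^sup>+t. (\<integral>\<^sup>+z. k z t \<partial>lborel) \<partial>lborel)
      \<le> ennreal (unit_ball_vol n) * ennreal ((2 * d) powr \<alpha> / \<alpha>)" .
  have [measurable]: "(\<lambda>z. \<integral>\<^sup>+t. k z t \<partial>lborel) \<in> borel_measurable lborel"
    by (rule lborel.borel_measurable_nn_integral) measurable
  have "(\<integral>\<^sup>+z\<in>cball (0::'a) d. ennreal (norm z powr (\<alpha> - n)) \<partial>lborel)
      \<le> (\<integral>\<^sup>+z. ennreal (2 ^ (n + 1)) * (\<integral>\<^sup>+t. k z t \<partial>lborel) \<partial>lborel)"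
    by (rule nn_integral_mono) (rule pointwise)
  also have "\<dots> = ennreal (2 ^ (n + 1)) * (\<integral>\<^sup>+z. (\<integral>\<^sup>+t. k z t \<partial>lborel) \<partial>lborel)"
    by (rule nn_integral_cmult) measurable
  also have "(\<integral>\<^sup>+z. (\<integral>\<^sup>+t. k z t \<partial>lborel) \<partial>lborel) = (\<integral>\<^sup>+t. (\<integral>\<^sup>+z. k z t \<partial>lborel) \<partial>lborel)"
    by (rule lborel_pair.Fubini'[symmetric]) measurable
  also have "ennreal (2 ^ (n + 1)) * \<dots>
      \<le> ennreal (2 ^ (n + 1)) * (ennreal (unit_ball_vol n) * ennreal ((2 * d) powr \<alpha> / \<alpha>))"
    by (intro mult_left_mono inner) simp
  also have "\<dots> = ennreal (2 ^ (n + 1) * unit_ball_vol n * ((2 * d) powr \<alpha> / \<alpha>))"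
    by (simp only: ennreal_mult' mult.assoc unit_ball_vol_nonneg zero_le_power zero_le_numeral
        zero_le_mult_iff)
  finally show ?thesis .
qed

text \<open>For fixed \<open>x\<close> in \<open>\<Omega>\<close>, the translation
  \<open>z = y - x\<close> moves \<open>\<Omega>\<close> into the ball of radius \<open>d\<close>
  around 0. The inner integral is thus bounded independently of \<open>x\<close>, and the outer one
  contributes the volume of \<open>\<Omega>\<close>.\<close>

lemma nn_integral_dist_powr_le:
  fixes \<Omega> :: "'a::euclidean_space set" and \<alpha> d :: real
  defines "n \<equiv> DIM('a)"
  assumes \<alpha>: "0 < \<alpha>" and \<Omega>: "\<Omega> \<in> sets borel" and d: "\<And>x y. x \<in> \<Omega> \<Longrightarrow> y \<in> \<Omega> \<Longrightarrow> norm (x - y) \<le> d" "0 \<le> d"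
  shows "(\<integral>\<^sup>+(x, y)\<in>\<Omega> \<times> \<Omega>. ennreal (norm (x - y) powr (\<alpha> - n)) \<partial>lebesgue)
    \<le> ennreal (2 ^ (n + 1) * unit_ball_vol n * ((2 * d) powr \<alpha> / \<alpha>)) * emeasure lborel \<Omega>"
    (is "_ \<le> ?K * _")
proof -
  note [measurable] = \<Omega>
  define k where "k z = ennreal (norm z powr (\<alpha> - n)) * indicator (cball 0 d) z" for z :: 'a
  have [measurable]: "k \<in> borel_measurable borel"
    unfolding k_def by (intro borel_measurable_times_ennreal borel_measurable_indicator) auto
  have "(\<integral>\<^sup>+(x, y)\<in>\<Omega> \<times> \<Omega>. ennreal (norm (x - y) powr (\<alpha> - n)) \<partial>lebesgue)
      \<le> (\<integral>\<^sup>+(x, y). indicator \<Omega> x * k (y - x) \<partial>(lborel \<Otimes>\<^sub>M lborel))"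
    unfolding nn_integral_completion lborel_prod
    using d by (intro nn_integral_mono) (auto simp: k_def norm_minus_commute split: split_indicator)
  also have "\<dots> = (\<integral>\<^sup>+x. \<integral>\<^sup>+y. indicator \<Omega> x * k (y - x) \<partial>lborel \<partial>lborel)"
    by (subst lborel.nn_integral_fst[symmetric]) simp_all
  also have "\<dots> = (\<integral>\<^sup>+x. indicator \<Omega> x * (\<integral>\<^sup>+z. k z \<partial>lborel) \<partial>lborel)"
  proof (rule nn_integral_cong)
    fix x
    have "(\<integral>\<^sup>+y. k (y - x) \<partial>lborel) = (\<integral>\<^sup>+y. k (y - x) \<partial>distr lborel borel ((+) x))"
      by (simp add: lborel_distr_plus)
    also have "\<dots> = (\<integral>\<^sup>+z. k z \<partial>lborel)"
      by (subst nn_integral_distr) simp_all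
    finally show "(\<integral>\<^sup>+y. indicator \<Omega> x * k (y - x) \<partial>lborel) = indicator \<Omega> x * (\<integral>\<^sup>+z. k z \<partial>lborel)"
      by (subst nn_integral_cmult) simp_all
  qed
  also have "\<dots> = (\<integral>\<^sup>+z. k z \<partial>lborel) * emeasure lborel \<Omega>"
    by (subst nn_integral_multc) (simp_all add: mult.commute)
  also have "\<dots> \<le> ?K * emeasure lborel \<Omega>"
    using nn_integral_norm_powr_cball_le[where 'a='a, OF \<alpha> d(2)]
    by (intro mult_right_mono) (simp_all add: n_def k_def)
  finally show ?thesis .
qed

section \<open>The embedding on bounded domains\<close>

text \<open>The normalisation \<open>1 \<le> d\<close> makes powers of \<open>d\<close> and
  \<open>2 * d\<close> increase with the exponent.\<close>

lemma bounded_imp_diff_le: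
  fixes S :: "'a::real_normed_vector set"
  assumes "bounded S"
  obtains d where "1 \<le> d" "\<And>x y. x \<in> S \<Longrightarrow> y \<in> S \<Longrightarrow> norm (x - y) \<le> d"
proof -
  obtain B where "\<And>x. x \<in> S \<Longrightarrow> norm x \<le> B"
    using assms by (auto simp: bounded_iff)
  then have "norm (x - y) \<le> max 1 (2 * B)" if "x \<in> S" "y \<in> S" for x y
    using norm_triangle_ineq4[of x y] that by (smt (verit))
  then show ?thesis by (intro that[of "max 1 (2 * B)"]) auto
qed

text \<open>This serves the case \<open>r = p\<close>, where Hoelder's inequality degenerates. The
  integrands differ by the factor \<open>norm (x - y) powr ((s2 - s1) * p)\<close>, which is at most
  \<open>d powr p\<close> uniformly in \<open>s1\<close> and \<open>s2\<close>.\<close>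

lemma magnetic_energy_le:
  fixes \<Omega> :: "(real ^ 'n) set"
  assumes d: "\<And>x y. x \<in> \<Omega> \<Longrightarrow> y \<in> \<Omega> \<Longrightarrow> norm (x - y) \<le> d" "1 \<le> d"
    and "0 < p" and s: "0 < s1" "s1 \<le> s2" "s2 \<le> 1" and "open \<Omega>"
    and A: "bounded_field \<Omega> A" and f: "in_Lp \<Omega> q f"
  shows "magnetic_energy (\<Omega> \<times> \<Omega>) A s1 p f \<le> ennreal (d powr p) * magnetic_energy (\<Omega> \<times> \<Omega>) A s2 p f"
proof -
  let ?N = "real CARD('n)" and ?D = "magnetic_diff A f"
  have pointwise: "norm (?D x y) powr p / norm (x - y) powr (?N + s1 * p)
      \<le> d powr p * (norm (?D x y) powr p / norm (x - y) powr (?N + s2 * p))"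
    if "x \<in> \<Omega>" "y \<in> \<Omega>" for x y
  proof (cases "x = y")
    case False
    let ?z = "norm (x - y)"
    have "?z powr ((s2 - s1) * p) \<le> d powr ((s2 - s1) * p)"
      using d(1)[OF that] s \<open>0 < p\<close> by (intro powr_mono2) auto
    also have "\<dots> \<le> d powr p"
      using d s \<open>0 < p\<close> by (intro powr_mono) (auto simp: mult_le_cancel_right1)
    finally have *: "?z powr ((s2 - s1) * p) \<le> d powr p" .
    have "norm (?D x y) powr p / ?z powr (?N + s1 * p)
        = ?z powr ((s2 - s1) * p) * (norm (?D x y) powr p / ?z powr (?N + s2 * p))"
      using False by (simp add: left_diff_distrib powr_diff powr_add)
    also have "\<dots> \<le> d powr p * (norm (?D x y) powr p / ?z powr (?N + s2 * p))"
      using * by (intro mult_right_mono) auto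
    finally show ?thesis .
  qed simp
  have [simp]: "\<Omega> \<times> \<Omega> \<in> sets lebesgue"
    using \<open>open \<Omega>\<close> by (simp add: open_Times)
  have meas: "(\<lambda>z. case z of (x, y) \<Rightarrow> norm (?D x y) powr p / norm (x - y) powr (?N + s2 * p)
      * indicator (\<Omega> \<times> \<Omega>) (x, y)) \<in> borel_measurable lebesgue" (is "?u \<in> _")
    using \<open>open \<Omega>\<close> A f by (intro borel_measurable_magnetic_energy) auto
  have "magnetic_energy (\<Omega> \<times> \<Omega>) A s1 p f \<le> (\<integral>\<^sup>+z. ennreal (d powr p) * ennreal (?u z) \<partial>lebesgue)"
    unfolding magnetic_energy_def
  proof (rule nn_integral_mono)
    fix z
    show "(case z of (x, y) \<Rightarrow> ennreal (norm (?D x y) powr p / norm (x - y) powr (?N + s1 * p)))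
        * indicator (\<Omega> \<times> \<Omega>) z \<le> ennreal (d powr p) * ennreal (?u z)"
      using pointwise
      by (cases "z \<in> \<Omega> \<times> \<Omega>") (auto simp flip: ennreal_mult' intro!: ennreal_leI)
  qed
  also have "\<dots> = ennreal (d powr p) * (\<integral>\<^sup>+z. ennreal (?u z) \<partial>lebesgue)"
    using meas by (intro nn_integral_cmult) simp
  also have "(\<integral>\<^sup>+z. ennreal (?u z) \<partial>lebesgue) = magnetic_energy (\<Omega> \<times> \<Omega>) A s2 p f"
    unfolding magnetic_energy_def
  proof (rule nn_integral_cong)
    fix z
    show "ennreal (?u z) = (case z of (x, y) \<Rightarrow>
        ennreal (norm (?D x y) powr p / norm (x - y) powr (?N + s2 * p))) * indicator (\<Omega> \<times> \<Omega>) z"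
      by (cases "z \<in> \<Omega> \<times> \<Omega>") (auto simp: split_beta)
  qed
  finally show ?thesis .
qed

text \<open>\<open>M\<close> must not depend on \<open>\<delta>\<close>: as
  \<open>\<delta> \<le> 1\<close>, the power \<open>(2 * d) powr (\<delta> * k)\<close> is at most
  \<open>(2 * d) powr k\<close>, so only \<open>1 / \<delta>\<close> remains.\<close>

lemma nn_integral_kernel_le:
  fixes \<Omega> :: "'a::euclidean_space set" and k :: real
  assumes "open \<Omega>" "bounded \<Omega>" "0 < k"
  obtains M where "0 < M" and "\<And>\<delta>. 0 < \<delta> \<Longrightarrow> \<delta> \<le> 1 \<Longrightarrow>
    (\<integral>\<^sup>+(x, y)\<in>\<Omega> \<times> \<Omega>. ennreal (norm (x - y) powr (\<delta> * k - DIM('a))) \<partial>lebesgue) \<le> ennreal (M / \<delta>)"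
proof -
  obtain d where d: "1 \<le> d" "\<And>x y. x \<in> \<Omega> \<Longrightarrow> y \<in> \<Omega> \<Longrightarrow> norm (x - y) \<le> d"
    using bounded_imp_diff_le[OF \<open>bounded \<Omega>\<close>] by metis
  let ?c = "2 ^ (DIM('a) + 1) * unit_ball_vol (real DIM('a))"
  obtain V where V: "emeasure lborel \<Omega> = ennreal V" "0 \<le> V"
    using emeasure_bounded_finite[OF \<open>bounded \<Omega>\<close>] by (cases "emeasure lborel \<Omega>") auto
  \<comment> \<open>The summand 1 keeps \<open>M\<close> positive even if \<open>\<Omega>\<close> is
    empty.\<close>
  define M where "M = ?c * ((2 * d) powr k / k) * V + 1"
  have c: "0 \<le> ?c" by simp
  show ?thesis
  proof (rule that)
    show "0 < M" using V c \<open>0 < k\<close> by (auto simp: M_def intro!: add_nonneg_pos)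
    fix \<delta> :: real assume \<delta>: "0 < \<delta>" "\<delta> \<le> 1"
    have "(\<integral>\<^sup>+(x, y)\<in>\<Omega> \<times> \<Omega>. ennreal (norm (x - y) powr (\<delta> * k - DIM('a))) \<partial>lebesgue)
        \<le> ennreal (?c * ((2 * d) powr (\<delta> * k) / (\<delta> * k))) * emeasure lborel \<Omega>"
      using assms d \<delta> by (intro nn_integral_dist_powr_le) auto
    also have "\<dots> = ennreal (?c * ((2 * d) powr (\<delta> * k) / (\<delta> * k)) * V)"
      unfolding V(1) by (rule ennreal_mult''[OF V(2), symmetric])
    also have "\<dots> \<le> ennreal (?c * ((2 * d) powr k / (\<delta> * k)) * V)" (is "_ \<le> ennreal ?b")
    proof -
      have "(2 * d) powr (\<delta> * k) \<le> (2 * d) powr k"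
        using d \<delta> \<open>0 < k\<close> by (intro powr_mono) (auto simp: mult_le_cancel_right1)
      then show ?thesis
        using V c \<delta> \<open>0 < k\<close> by (intro ennreal_leI mult_right_mono mult_left_mono divide_right_mono) auto
    qed
    also have "?b = ?c * ((2 * d) powr k / k) * V / \<delta>"
      by (simp add: mult.commute)
    also have "ennreal \<dots> \<le> ennreal (M / \<delta>)"
      using \<delta> unfolding M_def by (intro ennreal_leI divide_right_mono) auto
    finally show "(\<integral>\<^sup>+(x, y)\<in>\<Omega> \<times> \<Omega>. ennreal (norm (x - y) powr (\<delta> * k - DIM('a))) \<partial>lebesgue)
        \<le> ennreal (M / \<delta>)" .
  qed
qed

theorem lemma2p1:
  fixes \<Omega> :: "(real ^ 'n) set" and p r :: real
  assumes "1 \<le> r" and "r \<le> p" and "open \<Omega>"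
  shows
    "(r < p \<longrightarrow>
        (\<forall>s1 s2 H A f.
           0 < s1 \<longrightarrow> s1 < s2 \<longrightarrow> s2 < 1 \<longrightarrow>
           H \<in> sets lebesgue \<longrightarrow> H \<subseteq> \<Omega> \<times> \<Omega> \<longrightarrow>
           bounded_field \<Omega> A \<longrightarrow> in_Lp \<Omega> p f \<longrightarrow>
           magnetic_energy H A s1 r f
             \<le> enn_powr (magnetic_energy H A s2 p f) (r / p)
                * enn_powr
                    (\<integral>\<^sup>+(x, y)\<in>H. ennreal (norm (x - y) powr
                        ((real CARD('n) * r + s2 * r * p - real CARD('n) * p - s1 * r * p) / (p - r)))
                      \<partial>lebesgue)
                    ((p - r) / p)))
     \<and> (bounded \<Omega> \<longrightarrow>
        (\<exists>C::real. 0 < C \<and>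
          (\<forall>s1 s2 A f.
             0 < s1 \<longrightarrow> s1 < s2 \<longrightarrow> s2 < 1 \<longrightarrow>
             bounded_field \<Omega> A \<longrightarrow> in_Lp \<Omega> p f \<longrightarrow>
             enn_powr (magnetic_seminorm \<Omega> A s1 r f) r
               \<le> ennreal (C / (s2 - s1) powr ((p - r) / r))
                  * enn_powr (magnetic_seminorm \<Omega> A s2 p f) r)))"
    (is "(_ \<longrightarrow> ?Holder) \<and> (_ \<longrightarrow> ?embedding)")
proof (intro conjI impI)
  assume "r < p"
  then show ?Holder
    by (intro allI impI) (rule magnetic_energy_Holder[OF assms(1) _ assms(3)])
next
  assume "bounded \<Omega>"
  let ?E = "magnetic_energy (\<Omega> \<times> \<Omega>)" and ?N = "real CARD('n)"
  have semi1: "enn_powr (magnetic_seminorm \<Omega> A s r f) r = ?E A s r f" for A s f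
    using assms by (simp add: magnetic_seminorm_def enn_powr_enn_powr enn_powr_one)
  have semi2: "enn_powr (magnetic_seminorm \<Omega> A s p f) r = enn_powr (?E A s p f) (r / p)" for A s f
    by (simp add: magnetic_seminorm_def enn_powr_enn_powr)
  show ?embedding
  proof (cases "r = p")
    \<comment> \<open>The exponent \<open>(p - r) / r\<close> is now 0, so the factor in
      \<open>s2 - s1\<close> is 1.\<close>
    case True
    obtain d where d: "1 \<le> d" "\<And>x y. x \<in> \<Omega> \<Longrightarrow> y \<in> \<Omega> \<Longrightarrow> norm (x - y) \<le> d"
      using bounded_imp_diff_le[OF \<open>bounded \<Omega>\<close>] by metis
    show ?thesis
    proof (intro exI[of _ "d powr p"] conjI allI impI)
      show "0 < d powr p" using d by simp
      fix s1 s2 :: real and A :: "real ^ 'n \<Rightarrow> real ^ 'n" and f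
      assume "0 < s1" "s1 < s2" "s2 < 1" "bounded_field \<Omega> A" "in_Lp \<Omega> p f"
      then show "enn_powr (magnetic_seminorm \<Omega> A s1 r f) r
          \<le> ennreal (d powr p / (s2 - s1) powr ((p - r) / r)) * enn_powr (magnetic_seminorm \<Omega> A s2 p f) r"
        using magnetic_energy_le[OF d(2,1), of \<Omega> p s1 s2 A p f] assms True
        unfolding semi1 semi2 by (simp add: enn_powr_one)
    qed
  next
    case False
    then have pr: "1 \<le> r" "r < p" using assms by auto
    \<comment> \<open>With this \<open>k\<close> the exponent in Hoelder's inequality becomes
      \<open>(s2 - s1) * k\<close> minus the dimension.\<close>
    define k where "k = r * p / (p - r)"
    have "0 < k" using pr by (simp add: k_def)
    then obtain M where M: "0 < M" and kernel: "\<And>\<delta>. 0 < \<delta> \<Longrightarrow> \<delta> \<le> 1 \<Longrightarrow>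
        (\<integral>\<^sup>+(x, y)\<in>\<Omega> \<times> \<Omega>. ennreal (norm (x - y) powr (\<delta> * k - DIM(real^'n))) \<partial>lebesgue) \<le> ennreal (M / \<delta>)"
      using nn_integral_kernel_le[OF \<open>open \<Omega>\<close> \<open>bounded \<Omega>\<close>] by blast
    let ?q = "(p - r) / p"
    show ?thesis
    \<comment> \<open>\<open>M\<close> was obtained before \<open>s1\<close>, \<open>s2\<close>,
      \<open>A\<close> and \<open>f\<close> are fixed, so the constant is independent of
      them.\<close>
    proof (intro exI[of _ "M powr ?q"] conjI allI impI)
      show "0 < M powr ?q" using M by simp
      fix s1 s2 :: real and A :: "real ^ 'n \<Rightarrow> real ^ 'n" and f
      assume s: "0 < s1" "s1 < s2" "s2 < 1" and Af: "bounded_field \<Omega> A" "in_Lp \<Omega> p f"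
      let ?\<delta> = "s2 - s1"
      have "(?N * r + s2 * r * p - ?N * p - s1 * r * p) / (p - r) = ?\<delta> * k - DIM(real^'n)"
        using pr by (simp add: k_def field_simps)
      then have "?E A s1 r f \<le> enn_powr (?E A s2 p f) (r / p) * enn_powr
          (\<integral>\<^sup>+(x, y)\<in>\<Omega> \<times> \<Omega>. ennreal (norm (x - y) powr (?\<delta> * k - DIM(real^'n))) \<partial>lebesgue) ?q"
        using magnetic_energy_Holder[OF pr \<open>open \<Omega>\<close> _ _ Af, of "\<Omega> \<times> \<Omega>" s1 s2] \<open>open \<Omega>\<close>
        by (simp add: open_Times)
      also have "\<dots> \<le> enn_powr (?E A s2 p f) (r / p) * enn_powr (ennreal (M / ?\<delta>)) ?q"
        using s pr by (intro mult_left_mono enn_powr_mono kernel) auto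
      also have "enn_powr (ennreal (M / ?\<delta>)) ?q = ennreal (M powr ?q / ?\<delta> powr ?q)"
        using M s by (simp add: enn_powr_ennreal powr_divide)
      also have "enn_powr (?E A s2 p f) (r / p) * \<dots>
          \<le> enn_powr (?E A s2 p f) (r / p) * ennreal (M powr ?q / ?\<delta> powr ((p - r) / r))"
        using s pr M
        by (intro mult_left_mono ennreal_leI divide_left_mono powr_mono' mult_pos_pos frac_le) auto
      finally show "enn_powr (magnetic_seminorm \<Omega> A s1 r f) r
          \<le> ennreal (M powr ?q / ?\<delta> powr ((p - r) / r)) * enn_powr (magnetic_seminorm \<Omega> A s2 p f) r"
        unfolding semi1 semi2 by (simp add: mult.commute)
    qed
  qed
qed
end
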